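(* Let $p$ be an odd prime and $m,x\in\mathbb Z_p$. Then $$\sum_{k=0}^{p-1}\frac{G_k(x)}{m^k}\equiv\sum_{k=0}^{p-1}\frac{\binom xk\binom{-1-x}k}{(1-m)^k}\pmod p\quad\text{if }m\not\equiv0,1\pmod p,$$ $$\sum_{k=0}^{p-1}\binom{2k}k\frac{G_k(x)}{(m+2)^k}\equiv\left(\frac{(m+2)(m-2)}p\right)\sum_{k=0}^{p-1}\binom{2k}k\frac{\binom xk\binom{-1-x}k}{(2-m)^k}\pmod p\quad\text{if }m\not\equiv\pm2\pmod p.$$ Consequently, for $p>3$ and $m\in\mathbb Z_p$: $\sum_{k=0}^{p-1}\frac{G_k^{(3)}}{m^k}\equiv\sum_{k=0}^{p-1}\frac{\binom{2k}k\binom{3k}k}{(27-m)^k}\pmod p$ for $m\not\equiv0,27$; $\sum_{k=0}^{p-1}\frac{G_k^{(4)}}{m^k}\equiv\sum_{k=0}^{p-1}\frac{\binom{2k}k\binom{4k}{2k}}{(64-m)^k}\pmod p$ for $m\not\equiv0,64$; $\sum_{k=0}^{p-1}\frac{G_k^{(6)}}{m^k}\equiv\sum_{k=0}^{p-1}\frac{\binom{3k}k\binom{6k}{3k}}{(432-m)^k}\pmod p$ for $m\not\equiv0,432$; $\sum_{k=0}^{p-1}\binom{2k}k\frac{G_k^{(3)}}{m^k}\equiv\left(\frac{m(m-108)}p\right)\sum_{k=0}^{p-1}\frac{\binom{2k}k^2\binom{3k}k}{(108-m)^k}\pmod p$ for $m\not\equiv0,108$; $\sum_{k=0}^{p-1}\binom{2k}k\frac{G_k^{(4)}}{m^k}\equiv\left(\frac{m(m-256)}p\right)\sum_{k=0}^{p-1}\frac{\binom{2k}k^2\binom{4k}{2k}}{(256-m)^k}\pmod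 p$ for $m\not\equiv0,256$; $\sum_{k=0}^{p-1}\binom{2k}k\frac{G_k^{(6)}}{m^k}\equiv\left(\frac{m(m-1728)}p\right)\sum_{k=0}^{p-1}\frac{\binom{2k}k\binom{3k}k\binom{6k}{3k}}{(1728-m)^k}\pmod p$ for $m\not\equiv0,1728$ (all non-congruences modulo $p$).
   Context: For real $x$ and integer $k\ge0$, $\binom xk=x(x-1)\cdots(x-k+1)/k!$; $G_n(x)=\sum_{k=0}^n\binom nk(-1)^k\binom xk\binom{-1-x}k$. For a prime $p$, $\mathbb Z_p$ is the set of rationals with denominator prime to $p$; congruences mod $p$ are in $\mathbb Z_p$. $\left(\frac{\cdot}{p}\right)$ is the Legendre symbol. $G_n^{(3)}=27^nG_n(-\tfrac13)=\sum_{k=0}^n\binom nk(-1)^k\binom{2k}k\binom{3k}k27^{n-k}$, $G_n^{(4)}=64^nG_n(-\tfrac14)=\sum_{k=0}^n\binom nk(-1)^k\binom{2k}k\binom{4k}{2k}64^{n-k}$, $G_n^{(6)}=432^nG_n(-\tfrac16)=\sum_{k=0}^n\binom nk(-1)^k\binom{3k}k\binom{6k}{3k}432^{n-k}$. *)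

theory Defs
  imports Complex_Main "HOL-Number_Theory.Number_Theory"
begin

definition Zp :: "nat \<Rightarrow> rat set" where
  "Zp p = {a. coprime (snd (quotient_of a)) (int p)}"

definition cong_Zp :: "nat \<Rightarrow> rat \<Rightarrow> rat \<Rightarrow> bool" where
  "cong_Zp p a b \<longleftrightarrow> a \<in> Zp p \<and> b \<in> Zp p \<and> (\<exists>c \<in> Zp p. a - b = of_nat p * c)"

definition residue_Zp :: "nat \<Rightarrow> rat \<Rightarrow> int" where
  "residue_Zp p a = (THE r. 0 \<le> r \<and> r < int p \<and> cong_Zp p a (of_int r))"

text \<open>
  The Legendre symbol of an element of \<^term>\<open>Zp p\<close> is that of its residue modulo \<open>p\<close>;
  the lemmas below show that the residue is well defined and that on integers this is the
  usual symbol.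
\<close>

definition Legendre_Zp :: "rat \<Rightarrow> nat \<Rightarrow> int" where
  "Legendre_Zp a p = Legendre (residue_Zp p a) (int p)"

definition G :: "nat \<Rightarrow> rat \<Rightarrow> rat" where
  "G n x = (\<Sum>k=0..n. of_nat (n choose k) * (-1) ^ k * (x gchoose k) * ((-1 - x) gchoose k))"

definition G3 :: "nat \<Rightarrow> rat" where
  "G3 n = 27 ^ n * G n (- 1/3)"

definition G4 :: "nat \<Rightarrow> rat" where
  "G4 n = 64 ^ n * G n (- 1/4)"

definition G6 :: "nat \<Rightarrow> rat" where
  "G6 n = 432 ^ n * G n (- 1/6)"

lemma Zp_iff:
  "a \<in> Zp p \<longleftrightarrow> (\<exists>u v. coprime v (int p) \<and> v \<noteq> 0 \<and> a = of_int u / of_int v)"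
proof
  assume "a \<in> Zp p"
  obtain u v where uv: "quotient_of a = (u, v)" by fastforce
  have "v > 0" using quotient_of_denom_pos[OF uv] .
  moreover have "a = of_int u / of_int v" using quotient_of_div[OF uv] .
  moreover have "coprime v (int p)" using \<open>a \<in> Zp p\<close> uv by (simp add: Zp_def)
  ultimately show "\<exists>u v. coprime v (int p) \<and> v \<noteq> 0 \<and> a = of_int u / of_int v"
    by (metis less_irrefl)
next
  assume "\<exists>u v. coprime v (int p) \<and> v \<noteq> 0 \<and> a = of_int u / of_int v"
  then obtain u v where v: "coprime v (int p)" "v \<noteq> 0" and a: "a = of_int u / of_int v"
    by blast
  obtain s t where st: "quotient_of a = (s, t)" by fastforce
  have t: "t > 0" using quotient_of_denom_pos[OF st] .
  have cop: "coprime s t" using quotient_of_coprime[OF st] .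
  have "a = of_int s / of_int t" using quotient_of_div[OF st] .
  then have "of_int (u * t) = (of_int (s * v) :: rat)"
    using a v t by (simp add: field_simps)
  then have "u * t = s * v" by (simp only: of_int_eq_iff)
  then have "t dvd s * v" by (metis dvd_triv_right)
  then have "t dvd v" using cop
    by (simp add: coprime_commute coprime_dvd_mult_right_iff)
  then have "coprime t (int p)" using v(1) by (meson coprime_divisors dvd_refl)
  then show "a \<in> Zp p" using st by (simp add: Zp_def)
qed

lemma of_int_in_Zp [simp]: "of_int a \<in> Zp p"
  by (simp add: Zp_def)

lemma cong_Zp_of_int_iff:
  assumes "prime p"
  shows "cong_Zp p (of_int a) (of_int b) \<longleftrightarrow> [a = b] (mod int p)"
proof
  assume "cong_Zp p (of_int a) (of_int b)"
  then obtain c where c: "c \<in> Zp p" "of_int a - of_int b = of_nat p * c"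
    by (auto simp: cong_Zp_def)
  then obtain u v where v: "coprime v (int p)" "v \<noteq> 0" and cu: "c = of_int u / of_int v"
    by (auto simp: Zp_iff)
  have "of_int ((a - b) * v) = (of_int (int p * u) :: rat)"
    using c(2) cu v by (simp add: field_simps)
  then have "(a - b) * v = int p * u" by (simp only: of_int_eq_iff)
  then have "int p dvd (a - b) * v" by simp
  then have "int p dvd a - b"
    using v(1) by (simp add: coprime_commute coprime_dvd_mult_left_iff)
  then show "[a = b] (mod int p)" by (simp add: cong_iff_dvd_diff)
next
  assume "[a = b] (mod int p)"
  then obtain k where "a - b = int p * k" by (auto simp: cong_iff_dvd_diff)
  then have "of_int (a - b) = (of_int (int p * k) :: rat)" by simp
  then have "of_int a - of_int b = of_nat p * (of_int k :: rat)" by simp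
  then show "cong_Zp p (of_int a) (of_int b)"
    unfolding cong_Zp_def using of_int_in_Zp by blast
qed

lemma Zp_diff:
  assumes "a \<in> Zp p" "b \<in> Zp p"
  shows "a - b \<in> Zp p"
proof -
  obtain u v s t where "coprime v (int p)" "v \<noteq> 0" "a = of_int u / of_int v"
    "coprime t (int p)" "t \<noteq> 0" "b = of_int s / of_int t"
    using assms by (auto simp: Zp_iff)
  then have "coprime (v * t) (int p) \<and> v * t \<noteq> 0 \<and>
      a - b = of_int (u * t - s * v) / of_int (v * t)"
    by (simp add: diff_frac_eq)
  then show ?thesis unfolding Zp_iff by blast
qed

lemma cong_Zp_unique_residue:
  assumes p: "prime p" and a: "a \<in> Zp p"
  shows "\<exists>!r. 0 \<le> r \<and> r < int p \<and> cong_Zp p a (of_int r)"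
proof (rule ex_ex1I)
  obtain u v where v: "coprime v (int p)" "v \<noteq> 0" and au: "a = of_int u / of_int v"
    using a by (auto simp: Zp_iff)
  obtain w where w: "[v * w = 1] (mod int p)"
    using v(1) cong_solve_coprime_int by blast
  define r where "r = (u * w) mod int p"
  have "[v * r = v * (u * w)] (mod int p)"
    unfolding r_def by (simp add: cong_def mod_mult_right_eq)
  also have "v * (u * w) = u * (v * w)" by simp
  also have "[u * (v * w) = u * 1] (mod int p)" using w cong_scalar_left by blast
  finally have "[u = v * r] (mod int p)" by (simp add: cong_sym)
  then obtain k where k: "u - v * r = int p * k" by (auto simp: cong_iff_dvd_diff)
  then have "of_int (u - v * r) = (of_int (int p * k) :: rat)" by simp
  then have "a - of_int r = of_nat p * (of_int k / of_int v)"
    using au v by (simp add: field_simps)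
  moreover have "of_int k / of_int v \<in> Zp p" using v by (auto simp: Zp_iff)
  ultimately have "cong_Zp p a (of_int r)" 
    unfolding cong_Zp_def using a of_int_in_Zp by blast
  moreover have "0 \<le> r" "r < int p" using p by (auto simp: r_def prime_gt_0_nat)
  ultimately show "\<exists>r. 0 \<le> r \<and> r < int p \<and> cong_Zp p a (of_int r)" by blast
next
  fix r s
  assume r: "0 \<le> r \<and> r < int p \<and> cong_Zp p a (of_int r)"
    and s: "0 \<le> s \<and> s < int p \<and> cong_Zp p a (of_int s)"
  then obtain c d where c: "c \<in> Zp p" "a - of_int r = of_nat p * c"
    and d: "d \<in> Zp p" "a - of_int s = of_nat p * d" by (auto simp: cong_Zp_def)
  then have "of_int r - of_int s = of_nat p * (d - c)" by (simp add: algebra_simps)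
  then have "cong_Zp p (of_int r) (of_int s)"
    using Zp_diff[OF d(1) c(1)] of_int_in_Zp unfolding cong_Zp_def by blast
  then have "[r = s] (mod int p)" using p by (simp add: cong_Zp_of_int_iff)
  then show "r = s" using r s by (simp add: cong_def)
qed

lemma Legendre_Zp_of_int:
  assumes "prime p"
  shows "Legendre_Zp (of_int a) p = Legendre a (int p)"
proof -
  have "0 \<le> residue_Zp p (of_int a) \<and> residue_Zp p (of_int a) < int p \<and>
      cong_Zp p (of_int a) (of_int (residue_Zp p (of_int a)))"
    unfolding residue_Zp_def
    by (rule theI') (rule cong_Zp_unique_residue[OF assms of_int_in_Zp])
  then have "[a = residue_Zp p (of_int a)] (mod int p)"
    using assms by (simp add: cong_Zp_of_int_iff)
  then show ?thesis
    unfolding Legendre_Zp_def Legendre_def QuadRes_def cong_def by simp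
qed

lemma gchoose_Suc_eq:
  "(a :: rat) gchoose Suc k = (a gchoose k) * (a - of_nat k) / of_nat (Suc k)"
  by (simp add: gbinomial_prod_rev)

lemma binomials3:
  "27 ^ k * ((- 1/3 :: rat) gchoose k) * ((-1 - (- 1/3)) gchoose k)
     = of_nat (((2*k) choose k) * ((3*k) choose k))"
proof -
  have "27 ^ k * ((- 1/3 :: rat) gchoose k) * ((- 2/3) gchoose k) = fact (3*k) / fact k ^ 3"
  proof (induction k)
    case (Suc k)
    have f: "fact (3 * Suc k) = (3*of_nat k+3) * (3*of_nat k+2) * (3*of_nat k+1) * (fact (3*k) :: rat)"
      by (simp add: algebra_simps numeral_3_eq_3)
    have "27 ^ Suc k * ((- 1/3 :: rat) gchoose Suc k) * ((- 2/3) gchoose Suc k)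
        = (27 ^ k * ((- 1/3 :: rat) gchoose k) * ((- 2/3) gchoose k))
          * (27 * (- 1/3 - of_nat k) * (- 2/3 - of_nat k) / of_nat (Suc k) ^ 2)"
      by (simp only: gchoose_Suc_eq power_Suc power2_eq_square times_divide_eq_left
        times_divide_eq_right mult_ac divide_divide_eq_left)
    also have "\<dots> = fact (3 * Suc k) / fact (Suc k) ^ 3"
    proof -
      have nz: "(1 + of_nat k :: rat) \<noteq> 0" by (metis of_nat_Suc of_nat_neq_0)
      show ?thesis unfolding Suc.IH f
        using nz by (simp add: divide_simps) (simp add: algebra_simps power2_eq_square power3_eq_cube)
    qed
    finally show ?case .
  qed simp
  moreover have "(of_nat (((2*k) choose k) * ((3*k) choose k)) :: rat) = fact (3*k) / fact k ^ 3"
    by (simp add: binomial_fact power3_eq_cube)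
  ultimately show ?thesis by simp
qed

lemma binomials4:
  "64 ^ k * ((- 1/4 :: rat) gchoose k) * ((-1 - (- 1/4)) gchoose k)
     = of_nat (((2*k) choose k) * ((4*k) choose (2*k)))"
proof -
  have "64 ^ k * ((- 1/4 :: rat) gchoose k) * ((- 3/4) gchoose k)
     = fact (4*k) / (fact k ^ 2 * fact (2*k))"
  proof (induction k)
    case (Suc k)
    have e: "4 * Suc k = Suc (Suc (Suc (Suc (4*k))))" "2 * Suc k = Suc (Suc (2*k))" by simp_all
    have f: "fact (4 * Suc k) = (4*of_nat k+4) * (4*of_nat k+3) * (4*of_nat k+2) * (4*of_nat k+1) * (fact (4*k) :: rat)"
      "fact (2 * Suc k) = (2*of_nat k+2) * (2*of_nat k+1) * (fact (2*k) :: rat)"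
      unfolding e fact_Suc by (simp_all add: add_ac mult_ac)
    have "64 ^ Suc k * ((- 1/4 :: rat) gchoose Suc k) * ((- 3/4) gchoose Suc k)
        = (64 ^ k * ((- 1/4 :: rat) gchoose k) * ((- 3/4) gchoose k))
          * (64 * (- 1/4 - of_nat k) * (- 3/4 - of_nat k) / of_nat (Suc k) ^ 2)"
      by (simp only: gchoose_Suc_eq power_Suc power2_eq_square times_divide_eq_left
        times_divide_eq_right mult_ac divide_divide_eq_left)
    also have "\<dots> = fact (4 * Suc k) / (fact (Suc k) ^ 2 * fact (2 * Suc k))"
    proof -
      have nz: "(1 + of_nat k :: rat) \<noteq> 0" by (metis of_nat_Suc of_nat_neq_0)
      have nz2: "(2 * of_nat k + 1 :: rat) \<noteq> 0" "(2 * of_nat k + 2 :: rat) \<noteq> 0"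
        using of_nat_0_le_iff[of k, where ?'a = rat] by linarith+
      show ?thesis unfolding Suc.IH f
        using nz nz2 by (simp add: divide_simps) (simp add: algebra_simps power2_eq_square)
    qed
    finally show ?case .
  qed simp
  moreover have "(of_nat (((2*k) choose k) * ((4*k) choose (2*k))) :: rat)
     = fact (4*k) / (fact k ^ 2 * fact (2*k))"
    by (simp add: binomial_fact power2_eq_square)
  ultimately show ?thesis by simp
qed

lemma binomials6:
  "432 ^ k * ((- 1/6 :: rat) gchoose k) * ((-1 - (- 1/6)) gchoose k)
     = of_nat (((3*k) choose k) * ((6*k) choose (3*k)))"
proof -
  have "432 ^ k * ((- 1/6 :: rat) gchoose k) * ((- 5/6) gchoose k)
     = fact (6*k) / (fact (3*k) * fact k * fact (2*k))"
  proof (induction k)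
    case (Suc k)
    have e: "6 * Suc k = Suc (Suc (Suc (Suc (Suc (Suc (6*k))))))" "2 * Suc k = Suc (Suc (2*k))"
      "3 * Suc k = Suc (Suc (Suc (3*k)))" by simp_all
    have f: "fact (6 * Suc k) = (6*of_nat k+6) * (6*of_nat k+5) * (6*of_nat k+4) * (6*of_nat k+3)
        * (6*of_nat k+2) * (6*of_nat k+1) * (fact (6*k) :: rat)"
      "fact (2 * Suc k) = (2*of_nat k+2) * (2*of_nat k+1) * (fact (2*k) :: rat)"
      "fact (3 * Suc k) = (3*of_nat k+3) * (3*of_nat k+2) * (3*of_nat k+1) * (fact (3*k) :: rat)"
      unfolding e fact_Suc by (simp_all add: add_ac mult_ac)
    have "432 ^ Suc k * ((- 1/6 :: rat) gchoose Suc k) * ((- 5/6) gchoose Suc k)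
        = (432 ^ k * ((- 1/6 :: rat) gchoose k) * ((- 5/6) gchoose k))
          * (432 * (- 1/6 - of_nat k) * (- 5/6 - of_nat k) / of_nat (Suc k) ^ 2)"
      by (simp only: gchoose_Suc_eq power_Suc power2_eq_square times_divide_eq_left
        times_divide_eq_right mult_ac divide_divide_eq_left)
    also have "\<dots> = fact (6 * Suc k) / (fact (3 * Suc k) * fact (Suc k) * fact (2 * Suc k))"
    proof -
      have nz: "(1 + of_nat k :: rat) \<noteq> 0" by (metis of_nat_Suc of_nat_neq_0)
      have nz2: "(2 * of_nat k + 1 :: rat) \<noteq> 0" "(2 * of_nat k + 2 :: rat) \<noteq> 0"
        "(3 * of_nat k + 1 :: rat) \<noteq> 0" "(3 * of_nat k + 2 :: rat) \<noteq> 0" "(3 * of_nat k + 3 :: rat) \<noteq> 0"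
        using of_nat_0_le_iff[of k, where ?'a = rat] by linarith+
      show ?thesis unfolding Suc.IH f
        using nz nz2 by (simp add: divide_simps) (simp add: algebra_simps power2_eq_square)
    qed
    finally show ?case .
  qed simp
  moreover have "(of_nat (((3*k) choose k) * ((6*k) choose (3*k))) :: rat)
     = fact (6*k) / (fact (3*k) * fact k * fact (2*k))"
    by (simp add: binomial_fact)
  ultimately show ?thesis by simp
qed

lemma scaled_G_sum:
  assumes "\<And>k. N ^ k * (x gchoose k) * ((-1 - x) gchoose k) = B k"
  shows "N ^ n * G n x = (\<Sum>k=0..n. of_nat (n choose k) * (-1) ^ k * B k * N ^ (n - k))"
  unfolding G_def sum_distrib_left
proof (rule sum.cong)
  fix k assume "k \<in> {0..n}"
  then have "N ^ n = N ^ k * N ^ (n - k)" by (simp flip: power_add)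
  then show "N ^ n * (of_nat (n choose k) * (-1) ^ k * (x gchoose k) * ((-1 - x) gchoose k))
      = of_nat (n choose k) * (-1) ^ k * B k * N ^ (n - k)"
    by (simp only: assms[symmetric] mult_ac)
qed simp

lemma G3_sum:
  "G3 n = (\<Sum>k=0..n. of_nat (n choose k) * (-1) ^ k
      * of_nat (((2*k) choose k) * ((3*k) choose k)) * 27 ^ (n - k))"
  unfolding G3_def by (rule scaled_G_sum[OF binomials3])

lemma G4_sum:
  "G4 n = (\<Sum>k=0..n. of_nat (n choose k) * (-1) ^ k
      * of_nat (((2*k) choose k) * ((4*k) choose (2*k))) * 64 ^ (n - k))"
  unfolding G4_def by (rule scaled_G_sum[OF binomials4])

lemma G6_sum:
  "G6 n = (\<Sum>k=0..n. of_nat (n choose k) * (-1) ^ k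
      * of_nat (((3*k) choose k) * ((6*k) choose (3*k))) * 432 ^ (n - k))"
  unfolding G6_def by (rule scaled_G_sum[OF binomials6])

end

(*
  Modulo p both weights w_k in the sums of w_k N^k G_k(x)/m^k are c^k (n choose k), for
  0 <= k < p: the weight 1 with c = -1, n = p - 1,
  and the weight (2k choose k) with c = -4, n = (p - 1)/2.  Exchanging the order of summation and
  using (n choose k)(k choose j) = (n choose j)(n-j choose k-j), the inner sum becomes a binomial
  expansion, which gives the right-hand side times (1 + c t)^n, where t = N/m.  That factor is 1 by
  Fermat's theorem for n = p - 1, and a Legendre symbol by Euler's criterion for n = (p - 1)/2.
  The parameter N is 1 for general x, and 27, 64, 432 for x = -1/3, -1/4, -1/6.
*)

theory Submission
  imports Defs
begin

section \<open>Ring structure of \<open>Zp p\<close> and congruences modulo p\<close>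

lemma Zp_0 [simp]: "0 \<in> Zp p" and Zp_1 [simp]: "1 \<in> Zp p"
  and Zp_of_nat [simp]: "of_nat n \<in> Zp p" and Zp_numeral [simp]: "numeral w \<in> Zp p"
  using of_int_in_Zp[of 0 p] of_int_in_Zp[of 1 p] of_int_in_Zp[of "int n" p]
    of_int_in_Zp[of "numeral w" p] by simp_all

lemma Zp_uminus [simp]: "a \<in> Zp p \<Longrightarrow> - a \<in> Zp p"
  using Zp_diff[of 0 p a] by simp

lemma Zp_add: "a \<in> Zp p \<Longrightarrow> b \<in> Zp p \<Longrightarrow> a + b \<in> Zp p"
  using Zp_diff[of a p "- b"] by simp

lemma Zp_mult:
  assumes "a \<in> Zp p" "b \<in> Zp p"
  shows "a * b \<in> Zp p"
proof -
  obtain u v s t where "coprime v (int p)" "v \<noteq> 0" "a = of_int u / of_int v"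
    "coprime t (int p)" "t \<noteq> 0" "b = of_int s / of_int t"
    using assms by (auto simp: Zp_iff)
  then have "coprime (v * t) (int p) \<and> v * t \<noteq> 0 \<and> a * b = of_int (u * s) / of_int (v * t)"
    by simp
  then show ?thesis unfolding Zp_iff by blast
qed

lemma Zp_power: "a \<in> Zp p \<Longrightarrow> a ^ n \<in> Zp p"
  by (induction n) (simp_all add: Zp_mult)

lemma Zp_sum: "(\<And>i. i \<in> A \<Longrightarrow> f i \<in> Zp p) \<Longrightarrow> sum f A \<in> Zp p"
  by (induction A rule: infinite_finite_induct) (simp_all add: Zp_add)

lemmas Zp_intros = Zp_diff Zp_add Zp_mult Zp_power

text \<open>Solved for \<open>a\<close>, so that witnesses for sums, products and chains of
  congruences can be read off by substitution.\<close>

lemma cong_Zp_iff: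
  "cong_Zp p a b \<longleftrightarrow> a \<in> Zp p \<and> b \<in> Zp p \<and> (\<exists>c \<in> Zp p. a = b + of_nat p * c)"
  unfolding cong_Zp_def by (auto simp: algebra_simps)

lemma cong_Zp_refl: "a \<in> Zp p \<Longrightarrow> cong_Zp p a a"
  unfolding cong_Zp_iff by (auto intro: bexI[of _ 0])

lemma cong_Zp_sym: "cong_Zp p a b \<Longrightarrow> cong_Zp p b a"
  unfolding cong_Zp_def using Zp_uminus by (metis minus_diff_eq mult_minus_right)

lemma cong_Zp_add:
  assumes "cong_Zp p a b" "cong_Zp p c d"
  shows "cong_Zp p (a + c) (b + d)"
proof -
  obtain u v where "u \<in> Zp p" "v \<in> Zp p" "a = b + of_nat p * u" "c = d + of_nat p * v"
    using assms by (auto simp: cong_Zp_iff)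
  then show ?thesis
    using assms unfolding cong_Zp_iff
    by (auto intro!: bexI[of _ "u + v"] Zp_intros simp: algebra_simps)
qed

lemma cong_Zp_mult:
  assumes "cong_Zp p a b" "cong_Zp p c d"
  shows "cong_Zp p (a * c) (b * d)"
proof -
  obtain u v where "u \<in> Zp p" "v \<in> Zp p" "a = b + of_nat p * u" "c = d + of_nat p * v"
    using assms by (auto simp: cong_Zp_iff)
  then show ?thesis
    using assms unfolding cong_Zp_iff
    \<comment> \<open>The witness is the cofactor of p in (b + p u)(d + p v) - b d.\<close>
    by (auto intro!: bexI[of _ "b * v + u * d + of_nat p * (u * v)"] Zp_intros simp: algebra_simps)
qed

lemma cong_Zp_trans [trans]:
  assumes "cong_Zp p a b" "cong_Zp p b c"
  shows "cong_Zp p a c"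
proof -
  obtain u v where "u \<in> Zp p" "v \<in> Zp p" "a = b + of_nat p * u" "b = c + of_nat p * v"
    using assms by (auto simp: cong_Zp_iff)
  then show ?thesis
    using assms unfolding cong_Zp_iff
    by (auto intro!: bexI[of _ "u + v"] Zp_intros simp: algebra_simps)
qed

lemma cong_Zp_diff_0_iff:
  assumes "a \<in> Zp p" "b \<in> Zp p"
  shows "cong_Zp p (a - b) 0 \<longleftrightarrow> cong_Zp p a b"
  using assms by (simp add: cong_Zp_def Zp_diff)

lemma cong_Zp_power: "cong_Zp p a b \<Longrightarrow> cong_Zp p (a ^ n) (b ^ n)"
  by (induction n) (simp_all add: cong_Zp_refl cong_Zp_mult)

lemma cong_Zp_prod:
  "(\<And>i. i \<in> A \<Longrightarrow> cong_Zp p (f i) (g i)) \<Longrightarrow> cong_Zp p (prod f A) (prod g A)"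
  by (induction A rule: infinite_finite_induct) (simp_all add: cong_Zp_refl cong_Zp_mult)

lemma cong_Zp_sum:
  "(\<And>i. i \<in> A \<Longrightarrow> cong_Zp p (f i) (g i)) \<Longrightarrow> cong_Zp p (sum f A) (sum g A)"
  by (induction A rule: infinite_finite_induct) (simp_all add: cong_Zp_refl cong_Zp_add)

section \<open>Units modulo p, Euler's criterion and Fermat's theorem\<close>

lemma Zp_inverse:
  assumes p: "prime p" and a: "a \<in> Zp p" "\<not> cong_Zp p a 0"
  shows "a \<noteq> 0" "inverse a \<in> Zp p"
proof -
  obtain u v where v: "coprime v (int p)" "v \<noteq> 0" and au: "a = of_int u / of_int v"
    using a by (auto simp: Zp_iff)
  show "a \<noteq> 0"
    using a cong_Zp_refl by auto
  \<comment> \<open>A numerator u = p w would exhibit a as p times w/v, with w/v in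
    \<open>Zp p\<close>, and so make it congruent to 0. Hence u is prime to p and can serve as the
    denominator of the inverse.\<close>
  have "\<not> int p dvd u"
  proof
    assume "int p dvd u"
    then obtain w where "u = int p * w" ..
    moreover have "of_int w / of_int v \<in> Zp p" using v by (auto simp: Zp_iff)
    ultimately show False
      using a au by (auto simp: cong_Zp_def)
  qed
  then have "coprime u (int p)" "u \<noteq> 0"
    using p prime_imp_coprime[of "int p" u] by (auto simp: coprime_commute)
  then have "coprime u (int p) \<and> u \<noteq> 0 \<and> inverse a = of_int v / of_int u"
    using au by simp
  then show "inverse a \<in> Zp p"
    unfolding Zp_iff by blast
qed

lemma Zp_divide:
  "prime p \<Longrightarrow> a \<in> Zp p \<Longrightarrow> b \<in> Zp p \<Longrightarrow> \<not> cong_Zp p b 0 \<Longrightarrow> a / b \<in> Zp p"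
  by (simp add: divide_inverse Zp_mult Zp_inverse)

lemma cong_Zp_residue:
  assumes "prime p" "a \<in> Zp p"
  shows "cong_Zp p a (of_int (residue_Zp p a))"
  using theI'[OF cong_Zp_unique_residue[OF assms]] unfolding residue_Zp_def by blast

text \<open>Euler's criterion holds for the integer residue of \<open>a\<close>, and taking powers
  respects the congruence between \<open>a\<close> and its residue.\<close>

lemma cong_Zp_Legendre:
  assumes "prime p" "odd p" "a \<in> Zp p"
  shows "cong_Zp p (of_int (Legendre_Zp a p)) (a ^ ((p - 1) div 2))"
proof -
  let ?r = "residue_Zp p a"
  have "p > 2"
    using assms prime_ge_2_nat[of p] by (cases "p = 2") auto
  then have "[Legendre ?r (int p) = ?r ^ ((p - 1) div 2)] (mod int p)"
    using euler_criterion[of p ?r] assms by simp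
  then have "cong_Zp p (of_int (Legendre_Zp a p)) (of_int (?r ^ ((p - 1) div 2)))"
    using assms by (simp only: cong_Zp_of_int_iff Legendre_Zp_def)
  also have "cong_Zp p (of_int (?r ^ ((p - 1) div 2))) (a ^ ((p - 1) div 2))"
    using cong_Zp_power[OF cong_Zp_sym[OF cong_Zp_residue]] assms by simp
  finally show ?thesis .
qed

lemma cong_Zp_fermat:
  assumes p: "prime p" and a: "a \<in> Zp p" "\<not> cong_Zp p a 0"
  shows "cong_Zp p (a ^ (p - 1)) 1"
proof -
  \<comment> \<open>\<open>fermat_theorem\<close> concerns natural numbers, so the residue is first
    written as a natural number r.\<close>
  have "0 \<le> residue_Zp p a"
    using theI'[OF cong_Zp_unique_residue[OF p a(1)]] unfolding residue_Zp_def by blast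
  then obtain r where "residue_Zp p a = int r"
    by (metis nonneg_int_cases)
  then have ar: "cong_Zp p a (of_nat r)"
    using cong_Zp_residue[OF p a(1)] by simp
  have "\<not> p dvd r"
    using ar a cong_Zp_trans[of p a "of_nat r" 0] cong_Zp_of_int_iff[OF p, of "int r" 0]
    by (auto simp: cong_0_iff)
  then have "[int (r ^ (p - 1)) = int 1] (mod int p)"
    using p fermat_theorem cong_int_iff by blast
  then have "cong_Zp p (of_int (int (r ^ (p - 1)))) (of_int (int 1))"
    using cong_Zp_of_int_iff p by blast
  then show ?thesis
    using cong_Zp_trans[OF cong_Zp_power[OF ar]] by simp
qed

section \<open>Generalized binomial coefficients modulo p\<close>

lemma Zp_fact [simp]: "fact k \<in> Zp p"
  by (metis Zp_of_nat of_nat_fact)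

lemma not_cong_Zp_fact:
  assumes "prime p" "k < p"
  shows "\<not> cong_Zp p (fact k) 0"
proof
  assume "cong_Zp p (fact k) 0"
  then have "cong_Zp p (of_int (int (fact k))) (of_int 0)"
    by (metis of_int_0 of_int_of_nat_eq of_nat_fact)
  then have "int p dvd int (fact k)"
    using cong_Zp_of_int_iff[OF assms(1)] cong_0_iff by blast
  then show False
    using assms prime_dvd_fact_iff[of p k] unfolding int_dvd_int_iff by simp
qed

text \<open>A polynomial in the upper argument with integer coefficients is divided by k!, which is
  a unit because k < p. This allows -1 and -1/2 to be replaced below by natural numbers congruent to
  them.\<close>

lemma cong_Zp_gbinomial:
  assumes "prime p" "k < p" "cong_Zp p a b"
  shows "cong_Zp p (a gchoose k) (b gchoose k)"
proof -
  have "cong_Zp p (\<Prod>i = 0..<k. a - of_nat i) (\<Prod>i = 0..<k. b - of_nat i)"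
    using cong_Zp_add[OF assms(3) cong_Zp_refl[of "- of_nat i" p for i]]
    by (intro cong_Zp_prod) simp
  moreover have "inverse (fact k) \<in> Zp p"
    using Zp_inverse not_cong_Zp_fact assms by simp
  ultimately show ?thesis
    unfolding gbinomial_prod_rev divide_inverse by (intro cong_Zp_mult cong_Zp_refl)
qed

lemma Zp_gbinomial: "prime p \<Longrightarrow> k < p \<Longrightarrow> a \<in> Zp p \<Longrightarrow> a gchoose k \<in> Zp p"
  using cong_Zp_gbinomial[OF _ _ cong_Zp_refl] cong_Zp_iff by blast

section \<open>Exact identities for the double sum\<close>

lemma binomial_transform_sum:
  fixes t :: "'a :: comm_ring_1"
  shows "(\<Sum>k=0..N. t ^ k * w k * (\<Sum>j=0..k. of_nat (k choose j) * (-1) ^ j * a j))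
    = (\<Sum>j=0..N. (-1) ^ j * a j * (\<Sum>k=0..N. of_nat (k choose j) * w k * t ^ k))"
proof -
  \<comment> \<open>Because (k choose j) = 0 for j > k, the inner range can be extended to j \<le>
    N; the two summations over a square then commute.\<close>
  have "(\<Sum>j=0..k. of_nat (k choose j) * (-1) ^ j * a j)
      = (\<Sum>j=0..N. of_nat (k choose j) * (-1) ^ j * a j)" if "k \<le> N" for k
    using that by (intro sum.mono_neutral_left) (auto simp: binomial_eq_0)
  then have "(\<Sum>k=0..N. t ^ k * w k * (\<Sum>j=0..k. of_nat (k choose j) * (-1) ^ j * a j))
     = (\<Sum>k=0..N. \<Sum>j=0..N. (-1) ^ j * a j * (of_nat (k choose j) * w k * t ^ k))"
    by (intro sum.cong) (simp_all add: sum_distrib_left mult_ac)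
  then show ?thesis
    by (subst (asm) sum.swap) (simp add: sum_distrib_left)
qed

text \<open>The power (1 + u)^(n - j) of the binomial expansion is written as a quotient, so that
  the factor (1 + u)^n no longer depends on j and can leave an outer sum over j. For j > n both
  sides vanish.\<close>

lemma choose_mult_power_sum:
  fixes u :: rat
  assumes "n \<le> N" "u \<noteq> -1"
  shows "(\<Sum>k=0..N. of_nat (k choose j) * of_nat (n choose k) * u ^ k)
    = of_nat (n choose j) * u ^ j * (1 + u) ^ n / (1 + u) ^ j"
proof (cases "j \<le> n")
  case True
  have "(\<Sum>k=0..N. of_nat (k choose j) * of_nat (n choose k) * u ^ k)
     = (\<Sum>k=j..n. of_nat (k choose j) * of_nat (n choose k) * u ^ k)"
    using assms by (intro sum.mono_neutral_right) (auto simp: binomial_eq_0_iff)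
  also have "\<dots> = (\<Sum>k=j..n. of_nat (n choose j) * u ^ j * (of_nat ((n - j) choose (k - j)) * u ^ (k - j)))"
  proof (intro sum.cong refl)
    fix k assume k: "k \<in> {j..n}"
    then have "(n choose k) * (k choose j) = (n choose j) * ((n - j) choose (k - j))"
      by (intro choose_mult) auto
    then have "(of_nat (n choose k) * of_nat (k choose j) :: rat)
        = of_nat (n choose j) * of_nat ((n - j) choose (k - j))"
      by (metis of_nat_mult)
    moreover have "u ^ k = u ^ j * u ^ (k - j)"
      using k by (simp flip: power_add)
    ultimately show "of_nat (k choose j) * of_nat (n choose k) * u ^ k
        = of_nat (n choose j) * u ^ j * (of_nat ((n - j) choose (k - j)) * u ^ (k - j))"
      by (simp add: mult_ac)
  qed
  also have "\<dots> = of_nat (n choose j) * u ^ j * (\<Sum>i=0..n - j. of_nat ((n - j) choose i) * u ^ i)"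
    unfolding sum_distrib_left
    using True by (intro sum.reindex_bij_witness[of _ "\<lambda>i. i + j" "\<lambda>k. k - j"]) auto
  also have "(\<Sum>i=0..n - j. of_nat ((n - j) choose i) * u ^ i) = (1 + u) ^ (n - j)"
    using binomial_ring[of u 1 "n - j"] by (simp add: add.commute atLeast0AtMost)
  also have "(1 + u) ^ (n - j) = (1 + u) ^ n / (1 + u) ^ j"
    using True assms by (intro power_diff) (auto simp: add_eq_0_iff)
  finally show ?thesis by simp
next
  case False
  then have "(k choose j) = 0 \<or> (n choose k) = 0" for k
    by (auto simp: binomial_eq_0_iff)
  then have "(\<Sum>k=0..N. of_nat (k choose j) * of_nat (n choose k) * u ^ k) = 0"
    by (intro sum.neutral) fastforce
  then show ?thesis using False by simp
qed

section \<open>The weights 1 and (2k choose k) modulo p, and the transform with such weights\<close>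

lemma cong_Zp_minus_one_power_choose:
  assumes p: "prime p" and k: "k < p"
  shows "cong_Zp p 1 ((-1) ^ k * of_nat ((p - 1) choose k))"
proof -
  \<comment> \<open>Thus -1 and p - 1 agree modulo p, and (p - 1 choose k) can be replaced by (-1
    choose k). The bound k < p makes p positive, so the natural subtraction p - 1 is exact.\<close>
  have "(-1 :: rat) - of_nat (p - 1) = of_nat p * (- 1)"
    using k by (simp add: of_nat_diff)
  then have "cong_Zp p (-1) (of_nat (p - 1))"
    unfolding cong_Zp_def by (metis Zp_1 Zp_of_nat Zp_uminus)
  then have "cong_Zp p ((-1) ^ k * ((-1) gchoose k)) ((-1) ^ k * of_nat ((p - 1) choose k))"
    unfolding binomial_gbinomial
    using p k by (intro cong_Zp_gbinomial cong_Zp_mult cong_Zp_refl) (simp_all add: Zp_power)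
  \<comment> \<open>Negating the upper index gives (-1 choose k) = (-1)^k (k choose k) =
    (-1)^k.\<close>
  moreover have "(-1) ^ k * ((-1 :: rat) gchoose k) = 1"
    using gbinomial_minus[of "1 :: rat" k] gbinomial_of_nat_symmetric[of k k, where ?'a = rat]
    by (simp add: binomial_gbinomial[symmetric] flip: power_mult_distrib)
  ultimately show ?thesis by simp
qed

text \<open>Both sides are 1 at k = 0 and gain the factor 2 (2k + 1) / (k + 1) when k increases by
  one.\<close>

lemma central_binomial_gbinomial:
  "(of_nat ((2 * k) choose k) :: rat) = (-4) ^ k * ((- 1/2) gchoose k)"
proof (induction k)
  case (Suc k)
  have nz: "(1 + of_nat k :: rat) \<noteq> 0"
    by (metis of_nat_Suc of_nat_neq_0)
  have f: "fact (2 * Suc k) = (2*of_nat k+2) * (2*of_nat k+1) * (fact (2*k) :: rat)"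
    by (simp add: algebra_simps)
  have "(of_nat ((2 * Suc k) choose Suc k) :: rat)
      = of_nat ((2 * k) choose k) * (2 * (2 * of_nat k + 1) / of_nat (Suc k))"
    using nz by (subst (1 2) binomial_fact) (simp_all add: f divide_simps, simp add: algebra_simps)
  then show ?case
    unfolding Suc.IH using nz by (simp add: gchoose_Suc_eq divide_simps) (simp add: algebra_simps)
qed simp

text \<open>In \<open>central_binomial_gbinomial\<close> the upper argument -1/2 is congruent to the
  natural number (p - 1)/2, since they differ by -p/2 and 2 is a unit.\<close>

lemma cong_Zp_central_binomial:
  assumes p: "prime p" "odd p" and k: "k < p"
  shows "cong_Zp p (of_nat ((2 * k) choose k)) ((-4) ^ k * of_nat (((p - 1) div 2) choose k))"
proof -
  have "\<not> [2 = 0] (mod int p)"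
    using p prime_ge_2_nat[of p] by (auto simp: cong_0_iff dest!: zdvd_imp_le)
  then have "\<not> cong_Zp p 2 0"
    using cong_Zp_of_int_iff[of p 2 0] p by simp
  then have half: "- 1 / 2 \<in> Zp p"
    using p by (intro Zp_divide) auto
  have "(of_nat ((p - 1) div 2) :: rat) = (of_nat p - 1) / 2"
    using p by (auto elim!: oddE)
  \<comment> \<open>The cofactor of p is again -1/2, so \<open>half\<close> supplies the witness as
    well.\<close>
  then have "- 1 / 2 - of_nat ((p - 1) div 2) = of_nat p * (- 1 / 2 :: rat)"
    by (simp add: field_simps)
  then have "cong_Zp p (- 1 / 2) (of_nat ((p - 1) div 2))"
    unfolding cong_Zp_def using half by (metis Zp_of_nat)
  then show ?thesis
    unfolding central_binomial_gbinomial binomial_gbinomial[of "(p - 1) div 2" k]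
    using p k by (intro cong_Zp_mult cong_Zp_gbinomial cong_Zp_refl) (simp_all add: Zp_power)
qed

text \<open>The congruence for \<open>w\<close> is used twice: forwards to make the inner sum a
  binomial expansion with u = c t, and backwards to turn the remaining c^j (n choose j) into w j.
  This is why the same weight appears on both sides.\<close>

lemma cong_Zp_binomial_transform:
  assumes p: "prime p"
    and w: "\<And>k. k < p \<Longrightarrow> cong_Zp p (w k) (c ^ k * of_nat (n choose k))" and n: "n \<le> p - 1"
    and c: "c \<in> Zp p" and t: "t \<in> Zp p" "\<not> cong_Zp p (1 + c * t) 0"
    and a: "\<And>k. k < p \<Longrightarrow> a k \<in> Zp p"
  shows "cong_Zp p (\<Sum>k=0..p-1. t ^ k * w k * (\<Sum>j=0..k. of_nat (k choose j) * (-1) ^ j * a j))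
    ((1 + c * t) ^ n * (\<Sum>k=0..p-1. w k * a k * (- t / (1 + c * t)) ^ k))"
proof -
  have lt: "k < p" if "k \<in> {0..p - 1}" for k
    using that p prime_gt_0_nat[of p] by auto
  have D: "1 + c * t \<in> Zp p"
    using c t by (simp add: Zp_intros)
  note inv = Zp_inverse[OF p D t(2)]
  have ne: "c * t \<noteq> -1"
    using inv(1) by auto
  have "cong_Zp p (\<Sum>k=0..p-1. t ^ k * w k * (\<Sum>j=0..k. of_nat (k choose j) * (-1) ^ j * a j))
     (\<Sum>j=0..p-1. (-1) ^ j * a j * (\<Sum>k=0..p-1. of_nat (k choose j) * (c ^ k * of_nat (n choose k)) * t ^ k))"
    unfolding binomial_transform_sum
    by (intro cong_Zp_sum cong_Zp_mult cong_Zp_refl w)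
       (auto intro!: Zp_intros a lt t)
  also have "(\<Sum>j=0..p-1. (-1) ^ j * a j * (\<Sum>k=0..p-1. of_nat (k choose j) * (c ^ k * of_nat (n choose k)) * t ^ k))
     = (\<Sum>j=0..p-1. (-1) ^ j * a j * (of_nat (n choose j) * (c * t) ^ j * (1 + c * t) ^ n / (1 + c * t) ^ j))"
    unfolding choose_mult_power_sum[OF n ne, symmetric]
    by (simp add: power_mult_distrib mult_ac)
  \<comment> \<open>The sign (-1)^j, the power t^j and the denominator combine into one j-th power;
    c^j is kept with (n choose j) to form the weight again.\<close>
  also have "\<dots> = (\<Sum>j=0..p-1. (1 + c * t) ^ n * (c ^ j * of_nat (n choose j) * a j * (- t / (1 + c * t)) ^ j))"
    by (intro sum.cong refl)
       (simp add: power_mult_distrib power_divide power_minus[of "t / (1 + c * t)" for t] mult_ac)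
  also have "cong_Zp p \<dots> (\<Sum>j=0..p-1. (1 + c * t) ^ n * (w j * a j * (- t / (1 + c * t)) ^ j))"
    by (intro cong_Zp_sum cong_Zp_mult cong_Zp_refl cong_Zp_sym[OF w])
       (auto intro!: Zp_power a lt D Zp_uminus Zp_divide[OF p] t)
  finally show ?thesis
    by (simp add: sum_distrib_left)
qed

section \<open>The weighted sums of \<open>G k x\<close> with a scaling parameter N\<close>

lemma G_alt:
  "G k x = (\<Sum>j=0..k. of_nat (k choose j) * (-1) ^ j * ((x gchoose j) * ((-1 - x) gchoose j)))"
  unfolding G_def by (simp add: mult_ac)

lemma Zp_gbinomial_mult:
  "prime p \<Longrightarrow> k < p \<Longrightarrow> x \<in> Zp p \<Longrightarrow> (x gchoose k) * ((-1 - x) gchoose k) \<in> Zp p"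
  by (intro Zp_mult Zp_gbinomial) (simp_all add: Zp_diff)

text \<open>With t = N/m the decisive quantity is 1 - t = (m - N)/m: the first condition on m puts t
  into \<open>Zp p\<close>, the second makes 1 - t a unit, as the transform and Fermat's theorem
  require.\<close>

lemma cong_Zp_sum_G:
  assumes p: "prime p" and N: "N \<in> Zp p" and m: "m \<in> Zp p" and x: "x \<in> Zp p"
    and nc: "\<not> cong_Zp p m 0" "\<not> cong_Zp p m N"
  shows "cong_Zp p (\<Sum>k=0..p-1. N ^ k * G k x / m ^ k)
    (\<Sum>k=0..p-1. N ^ k * ((x gchoose k) * ((-1 - x) gchoose k)) / (N - m) ^ k)"
proof -
  define t where "t = N / m"
  let ?a = "\<lambda>k. (x gchoose k) * ((-1 - x) gchoose k)"
  have t: "t \<in> Zp p"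
    unfolding t_def using p N m nc by (simp add: Zp_divide)
  have m0: "m \<noteq> 0"
    using Zp_inverse p m nc by blast
  have D: "1 + (-1) * t = (m - N) / m"
    using m0 by (simp add: t_def field_simps)
  have mN: "\<not> cong_Zp p (m - N) 0" "m \<noteq> N"
    using cong_Zp_diff_0_iff[OF m N] nc cong_Zp_refl[OF m] by auto
  \<comment> \<open>Multiplying a congruence (m - N)/m = 0 by m would give m - N = 0 modulo
    p.\<close>
  have unit: "\<not> cong_Zp p (1 + (-1) * t) 0"
    using cong_Zp_mult[OF _ cong_Zp_refl[OF m], of "(m - N) / m" 0] mN m0 unfolding D by auto
  have ratio: "- t / (1 + (-1) * t) = N / (N - m)"
    unfolding D unfolding t_def using m0 mN by (simp add: field_simps)
  have S: "(\<Sum>k=0..p-1. 1 * ?a k * (- t / (1 + (-1) * t)) ^ k) \<in> Zp p"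
  proof (rule Zp_sum)
    fix k assume "k \<in> {0..p - 1}"
    then have "k < p"
      using prime_gt_0_nat[OF p] by auto
    then have "?a k \<in> Zp p"
      using Zp_gbinomial_mult x p by blast
    moreover have "- t / (1 + (-1) * t) \<in> Zp p"
      using t unit by (intro Zp_divide[OF p] Zp_add Zp_mult) auto
    ultimately show "1 * ?a k * (- t / (1 + (-1) * t)) ^ k \<in> Zp p"
      by - (rule Zp_mult[OF Zp_mult Zp_power], simp_all)
  qed
  \<comment> \<open>The explicit 1 is the constant weight \<open>w k\<close>, and (-1) * t has the
    form c * t of the transform.\<close>
  have "cong_Zp p (\<Sum>k=0..p-1. t ^ k * 1 * (\<Sum>j=0..k. of_nat (k choose j) * (-1) ^ j * ?a j))
    ((1 + (-1) * t) ^ (p - 1) * (\<Sum>k=0..p-1. 1 * ?a k * (- t / (1 + (-1) * t)) ^ k))"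
    using p t unit x
    by (intro cong_Zp_binomial_transform cong_Zp_minus_one_power_choose Zp_gbinomial_mult) auto
  also have "cong_Zp p \<dots> (1 * (\<Sum>k=0..p-1. 1 * ?a k * (- t / (1 + (-1) * t)) ^ k))"
    using p t unit S by (intro cong_Zp_mult cong_Zp_fermat cong_Zp_refl) (auto simp: Zp_diff)
  finally show ?thesis
    unfolding ratio G_alt[symmetric] by (simp add: t_def power_divide mult_ac)
qed

text \<open>Since a/b = ab/b^2 and (b^2)^((p - 1)/2) = b^(p - 1) is 1 modulo p, Euler's criterion
  for ab also evaluates the power of the quotient.\<close>

lemma cong_Zp_Legendre_quotient:
  assumes p: "prime p" "odd p" and ab: "a \<in> Zp p" "b \<in> Zp p" "\<not> cong_Zp p b 0"
  shows "cong_Zp p ((a / b) ^ ((p - 1) div 2)) (of_int (Legendre_Zp (b * a) p))"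
proof -
  let ?n = "(p - 1) div 2"
  have b: "b \<noteq> 0" "a / b \<in> Zp p"
    using Zp_inverse Zp_divide p ab by blast+
  have "cong_Zp p ((a / b) ^ ?n * 1) ((a / b) ^ ?n * b ^ (p - 1))"
    using cong_Zp_sym[OF cong_Zp_fermat] p ab b by (intro cong_Zp_mult cong_Zp_refl Zp_power) auto
  also have "(a / b) ^ ?n * b ^ (p - 1) = (a / b) ^ ?n * (b ^ 2) ^ ?n"
    using p(2) by (simp flip: power_mult)
  also have "\<dots> = (b * a) ^ ?n"
    using b by (simp add: power2_eq_square mult.commute flip: power_mult_distrib)
  also have "cong_Zp p \<dots> (of_int (Legendre_Zp (b * a) p))"
    using cong_Zp_sym[OF cong_Zp_Legendre] p ab by (simp add: Zp_mult)
  finally show ?thesis by simp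
qed

text \<open>Here c = -4, so that 1 - 4t = (m - 4N)/m. Its power with exponent (p - 1)/2 gives the
  Legendre symbol of the product of numerator and denominator.\<close>

lemma cong_Zp_sum_central_binomial_G:
  assumes p: "prime p" "odd p" and N: "N \<in> Zp p" and m: "m \<in> Zp p" and x: "x \<in> Zp p"
    and nc: "\<not> cong_Zp p m 0" "\<not> cong_Zp p m (4 * N)"
  shows "cong_Zp p (\<Sum>k=0..p-1. of_nat ((2*k) choose k) * (N ^ k * G k x) / m ^ k)
    (of_int (Legendre_Zp (m * (m - 4 * N)) p) *
     (\<Sum>k=0..p-1. of_nat ((2*k) choose k) * (N ^ k * ((x gchoose k) * ((-1 - x) gchoose k))) / (4 * N - m) ^ k))"
proof -
  define t where "t = N / m"
  let ?a = "\<lambda>k. (x gchoose k) * ((-1 - x) gchoose k)"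
  let ?w = "\<lambda>k. of_nat ((2 * k) choose k) :: rat"
  let ?n = "(p - 1) div 2"
  have t: "t \<in> Zp p"
    unfolding t_def using p N m nc by (simp add: Zp_divide)
  have m0: "m \<noteq> 0"
    using Zp_inverse p m nc by blast
  have N4: "4 * N \<in> Zp p"
    using N by (simp add: Zp_mult)
  have D: "1 + (-4) * t = (m - 4 * N) / m"
    using m0 by (simp add: t_def field_simps)
  have mN: "\<not> cong_Zp p (m - 4 * N) 0" "m \<noteq> 4 * N"
    using cong_Zp_diff_0_iff[OF m N4] nc cong_Zp_refl[OF m] by auto
  have unit: "\<not> cong_Zp p (1 + (-4) * t) 0"
    using cong_Zp_mult[OF _ cong_Zp_refl[OF m], of "(m - 4 * N) / m" 0] mN m0 unfolding D by auto
  have ratio: "- t / (1 + (-4) * t) = N / (4 * N - m)"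
    unfolding D unfolding t_def using m0 mN by (simp add: field_simps)
  have S: "(\<Sum>k=0..p-1. ?w k * ?a k * (- t / (1 + (-4) * t)) ^ k) \<in> Zp p"
  proof (rule Zp_sum)
    fix k assume "k \<in> {0..p - 1}"
    then have "k < p"
      using prime_gt_0_nat[OF p(1)] by auto
    then have "?a k \<in> Zp p"
      using Zp_gbinomial_mult x p(1) by blast
    moreover have "- t / (1 + (-4) * t) \<in> Zp p"
      using t unit by (intro Zp_divide[OF p(1)] Zp_add Zp_mult) auto
    ultimately show "?w k * ?a k * (- t / (1 + (-4) * t)) ^ k \<in> Zp p"
      by - (rule Zp_mult[OF Zp_mult Zp_power], simp_all)
  qed
  have "cong_Zp p (\<Sum>k=0..p-1. t ^ k * ?w k * (\<Sum>j=0..k. of_nat (k choose j) * (-1) ^ j * ?a j))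
    ((1 + (-4) * t) ^ ?n * (\<Sum>k=0..p-1. ?w k * ?a k * (- t / (1 + (-4) * t)) ^ k))"
    using p t unit x
    by (intro cong_Zp_binomial_transform cong_Zp_central_binomial Zp_gbinomial_mult) auto
  also have "cong_Zp p \<dots> (of_int (Legendre_Zp (m * (m - 4 * N)) p) *
      (\<Sum>k=0..p-1. ?w k * ?a k * (- t / (1 + (-4) * t)) ^ k))"
    using p m mN nc S Zp_diff[OF m N4] unfolding D
    by (intro cong_Zp_mult cong_Zp_Legendre_quotient cong_Zp_refl) auto
  finally show ?thesis
    unfolding ratio G_alt[symmetric] by (simp add: t_def power_divide mult_ac)
qed

section \<open>Specialization to the stated congruences\<close>

lemma Zp_minus_inverse_numeral:
  assumes "prime p" "\<not> p dvd numeral w"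
  shows "- 1 / numeral w \<in> Zp p"
proof -
  have "\<not> cong_Zp p (of_int (numeral w)) (of_int 0)"
    using assms by (simp only: cong_Zp_of_int_iff) (simp add: cong_0_iff int_dvd_int_iff[symmetric])
  then show ?thesis
    using assms by (intro Zp_divide) auto
qed

theorem theorem3p7:
  fixes p :: nat
  assumes "prime p" and "odd p"
  shows
    "(\<forall>m \<in> Zp p. \<forall>x \<in> Zp p.
        (\<not> cong_Zp p m 0 \<and> \<not> cong_Zp p m 1 \<longrightarrow>
          cong_Zp p (\<Sum>k=0..p-1. G k x / m ^ k)
            (\<Sum>k=0..p-1. (x gchoose k) * ((-1 - x) gchoose k) / (1 - m) ^ k)) \<and>
        (\<not> cong_Zp p m 2 \<and> \<not> cong_Zp p m (-2) \<longrightarrow>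
          cong_Zp p (\<Sum>k=0..p-1. of_nat ((2*k) choose k) * G k x / (m + 2) ^ k)
            (of_int (Legendre_Zp ((m + 2) * (m - 2)) p) *
             (\<Sum>k=0..p-1. of_nat ((2*k) choose k) * ((x gchoose k) * ((-1 - x) gchoose k)) / (2 - m) ^ k)))) \<and>
     (p > 3 \<longrightarrow> (\<forall>m \<in> Zp p.
        (\<not> cong_Zp p m 0 \<and> \<not> cong_Zp p m 27 \<longrightarrow>
          cong_Zp p (\<Sum>k=0..p-1. G3 k / m ^ k)
            (\<Sum>k=0..p-1. of_nat ((2*k) choose k) * of_nat ((3*k) choose k) / (27 - m) ^ k)) \<and>
        (\<not> cong_Zp p m 0 \<and> \<not> cong_Zp p m 64 \<longrightarrow>
          cong_Zp p (\<Sum>k=0..p-1. G4 k / m ^ k)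
            (\<Sum>k=0..p-1. of_nat ((2*k) choose k) * of_nat ((4*k) choose (2*k)) / (64 - m) ^ k)) \<and>
        (\<not> cong_Zp p m 0 \<and> \<not> cong_Zp p m 432 \<longrightarrow>
          cong_Zp p (\<Sum>k=0..p-1. G6 k / m ^ k)
            (\<Sum>k=0..p-1. of_nat ((3*k) choose k) * of_nat ((6*k) choose (3*k)) / (432 - m) ^ k)) \<and>
        (\<not> cong_Zp p m 0 \<and> \<not> cong_Zp p m 108 \<longrightarrow>
          cong_Zp p (\<Sum>k=0..p-1. of_nat ((2*k) choose k) * G3 k / m ^ k)
            (of_int (Legendre_Zp (m * (m - 108)) p) *
             (\<Sum>k=0..p-1. of_nat ((2*k) choose k) ^ 2 * of_nat ((3*k) choose k) / (108 - m) ^ k))) \<and>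
        (\<not> cong_Zp p m 0 \<and> \<not> cong_Zp p m 256 \<longrightarrow>
          cong_Zp p (\<Sum>k=0..p-1. of_nat ((2*k) choose k) * G4 k / m ^ k)
            (of_int (Legendre_Zp (m * (m - 256)) p) *
             (\<Sum>k=0..p-1. of_nat ((2*k) choose k) ^ 2 * of_nat ((4*k) choose (2*k)) / (256 - m) ^ k))) \<and>
        (\<not> cong_Zp p m 0 \<and> \<not> cong_Zp p m 1728 \<longrightarrow>
          cong_Zp p (\<Sum>k=0..p-1. of_nat ((2*k) choose k) * G6 k / m ^ k)
            (of_int (Legendre_Zp (m * (m - 1728)) p) *
             (\<Sum>k=0..p-1. of_nat ((2*k) choose k) * of_nat ((3*k) choose k) * of_nat ((6*k) choose (3*k)) / (1728 - m) ^ k)))))"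
proof (intro conjI ballI impI; (elim conjE)?)
  note p = assms
  have two: "2 \<in> Zp p"
    by simp
  fix m x
  assume m: "m \<in> Zp p" and x: "x \<in> Zp p"
  show "cong_Zp p (\<Sum>k=0..p-1. G k x / m ^ k)
      (\<Sum>k=0..p-1. (x gchoose k) * ((-1 - x) gchoose k) / (1 - m) ^ k)"
    if "\<not> cong_Zp p m 0" "\<not> cong_Zp p m 1"
    using cong_Zp_sum_G[OF p(1) _ m x that] by simp
  show "cong_Zp p (\<Sum>k=0..p-1. of_nat ((2*k) choose k) * G k x / (m + 2) ^ k)
      (of_int (Legendre_Zp ((m + 2) * (m - 2)) p) *
       (\<Sum>k=0..p-1. of_nat ((2*k) choose k) * ((x gchoose k) * ((-1 - x) gchoose k)) / (2 - m) ^ k))"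
    if "\<not> cong_Zp p m 2" "\<not> cong_Zp p m (-2)"
  proof -
    \<comment> \<open>The general result is applied with N = 1 and m + 2 in place of m: its excluded
      residues 0 and 4 correspond to m = -2 and m = 2, and 4 - (m + 2) = 2 - m.\<close>
    have "\<not> cong_Zp p (m + 2) 0" "\<not> cong_Zp p (m + 2) 4"
      using that m cong_Zp_diff_0_iff[of m p 2] cong_Zp_diff_0_iff[of m p "-2"]
        cong_Zp_diff_0_iff[of "m + 2" p 4] by (simp_all add: Zp_add)
    then show ?thesis
      using cong_Zp_sum_central_binomial_G[OF p Zp_1 Zp_add[OF m two] x] by simp
  qed
next
  note p = assms
  fix m
  assume "p > 3" and m: "m \<in> Zp p"
  \<comment> \<open>2 and 3 are the only primes dividing 3, 4 or 6, so p > 3 puts -1/3, -1/4 and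
    -1/6 into \<open>Zp p\<close>.\<close>
  have "\<not> p dvd 3" "\<not> p dvd 2"
    using \<open>p > 3\<close> by (auto dest: dvd_imp_le)
  then have "\<not> p dvd 3" "\<not> p dvd 4" "\<not> p dvd 6"
    using prime_dvd_mult_iff[OF p(1), of 2 2] prime_dvd_mult_iff[OF p(1), of 2 3] by auto
  then have x: "- 1 / 3 \<in> Zp p" "- 1 / 4 \<in> Zp p" "- 1 / 6 \<in> Zp p"
    using Zp_minus_inverse_numeral[OF p(1)] by blast+
  have N: "27 \<in> Zp p" "64 \<in> Zp p" "432 \<in> Zp p"
    by simp_all
  note one = cong_Zp_sum_G[OF p(1) _ m]
  note two = cong_Zp_sum_central_binomial_G[OF p _ m]
  show "cong_Zp p (\<Sum>k=0..p-1. G3 k / m ^ k)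
      (\<Sum>k=0..p-1. of_nat ((2*k) choose k) * of_nat ((3*k) choose k) / (27 - m) ^ k)"
    if "\<not> cong_Zp p m 0" "\<not> cong_Zp p m 27"
    \<comment> \<open>Left association exposes 27^k times both generalized binomials, which
      \<open>binomials3\<close> turns into the integer coefficient.\<close>
    using one[OF N(1) x(1) that] by (simp only: binomials3 G3_def of_nat_mult mult.assoc[symmetric])
  show "cong_Zp p (\<Sum>k=0..p-1. G4 k / m ^ k)
      (\<Sum>k=0..p-1. of_nat ((2*k) choose k) * of_nat ((4*k) choose (2*k)) / (64 - m) ^ k)"
    if "\<not> cong_Zp p m 0" "\<not> cong_Zp p m 64"
    using one[OF N(2) x(2) that] by (simp only: binomials4 G4_def of_nat_mult mult.assoc[symmetric])
  show "cong_Zp p (\<Sum>k=0..p-1. G6 k / m ^ k)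
      (\<Sum>k=0..p-1. of_nat ((3*k) choose k) * of_nat ((6*k) choose (3*k)) / (432 - m) ^ k)"
    if "\<not> cong_Zp p m 0" "\<not> cong_Zp p m 432"
    using one[OF N(3) x(3) that] by (simp only: binomials6 G6_def of_nat_mult mult.assoc[symmetric])
  have N4: "4 * 27 = (108 :: rat)" "4 * 64 = (256 :: rat)" "4 * 432 = (1728 :: rat)"
    by simp_all
  show "cong_Zp p (\<Sum>k=0..p-1. of_nat ((2*k) choose k) * G3 k / m ^ k)
      (of_int (Legendre_Zp (m * (m - 108)) p) *
       (\<Sum>k=0..p-1. of_nat ((2*k) choose k) ^ 2 * of_nat ((3*k) choose k) / (108 - m) ^ k))"
    if "\<not> cong_Zp p m 0" "\<not> cong_Zp p m 108"
    \<comment> \<open>Left association would now attach the leading (2k choose k) to 27^k and hide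
      the left side of \<open>binomials3\<close>, so everything is associated to the right.\<close>
    using two[OF N(1) x(1), unfolded N4, OF that]
    by (simp only: binomials3[unfolded mult.assoc] G3_def of_nat_mult power2_eq_square mult.assoc)
  show "cong_Zp p (\<Sum>k=0..p-1. of_nat ((2*k) choose k) * G4 k / m ^ k)
      (of_int (Legendre_Zp (m * (m - 256)) p) *
       (\<Sum>k=0..p-1. of_nat ((2*k) choose k) ^ 2 * of_nat ((4*k) choose (2*k)) / (256 - m) ^ k))"
    if "\<not> cong_Zp p m 0" "\<not> cong_Zp p m 256"
    using two[OF N(2) x(2), unfolded N4, OF that]
    by (simp only: binomials4[unfolded mult.assoc] G4_def of_nat_mult power2_eq_square mult.assoc)
  show "cong_Zp p (\<Sum>k=0..p-1. of_nat ((2*k) choose k) * G6 k / m ^ k)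
      (of_int (Legendre_Zp (m * (m - 1728)) p) *
       (\<Sum>k=0..p-1. of_nat ((2*k) choose k) * of_nat ((3*k) choose k) * of_nat ((6*k) choose (3*k)) / (1728 - m) ^ k))"
    if "\<not> cong_Zp p m 0" "\<not> cong_Zp p m 1728"
    using two[OF N(3) x(3), unfolded N4, OF that]
    by (simp only: binomials6[unfolded mult.assoc] G6_def of_nat_mult power2_eq_square mult.assoc)
qed

end
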